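(* Let $\sum(l_1,\dots,l_m;q)$ be a multigeometric series with sum $s$, let $E$ be its set of subsums and, for $n\in\mathbb N$, let $F_n$ be the set of its $n$-initial subsums. Put $\delta(F_m):=\min\{|f-g|:\ f,g\in F_m,\ f\neq g\}$. Suppose that $$2qs<\delta(F_m)\qquad\text{and}\qquad qs<1.$$ Then $$C(E)=\bigcup_{n=1}^\infty C(F_n).$$
   Context: Throughout, a series $\sum a_n$ is a convergent series $\sum_{n=1}^\infty a_n$ with positive and nonincreasing terms; $\mathbb N=\{1,2,\dots\}$ and $\mathbb N_0=\mathbb N\cup\{0\}$. A series $\sum a_n$ is multigeometric if there are positive integers $m$ and $l_1\ge l_2\ge\dots\ge l_m$ and a number $q\in(0,1)$ such that $a_{km+i}=l_iq^k$ for all $k\in\mathbb N_0$ and $i\in\{1,\dots,m\}$; it is denoted $\sum(l_1,\dots,l_m;q)$, and its sum is $s=\frac{1}{1-q}\sum_{i=1}^m l_i$. The set of subsums is $E:=\{\sum_{n\in A}a_n:\ A\subset\mathbb N\}$ and the set of $k$-initial subsums is $F_k:=\{\sum_{n\in A}a_n:\ A\subset\{1,\dots,k\}\}$ (the empty sum is $0$). For a nonempty subset $A$ of a metric space $(X,d)$, the center of distances of $A$ is $C(A):=\{\alpha\in[0,+\infty):\ \forall x\in A\ \exists y\in A\ d(x,y)=\alpha\}$; subsets of $\mathbb R$ carry the usual metric. *)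

theory Defs
  imports "HOL-Analysis.Analysis"
begin

text \<open>Series are indexed by the positive integers: a series is given by its sequence of
  terms \<open>a :: nat \<Rightarrow> real\<close>, and the value \<open>a 0\<close> is never used.\<close>

definition monotone_series :: "(nat \<Rightarrow> real) \<Rightarrow> bool" where
  "monotone_series a \<longleftrightarrow>
     (\<forall>n\<ge>1. 0 < a n) \<and> (\<forall>n\<ge>1. a (Suc n) \<le> a n) \<and> a summable_on {1..}"

text \<open>The parameters \<open>l\<^sub>1, \<dots>, l\<^sub>m\<close> are the values of \<open>l\<close> on \<open>{1..m}\<close>.
  Since every series is required to have nonincreasing terms, so is a multigeometric one;
  besides the monotonicity of \<open>l\<close> this amounts to \<open>q * l 1 \<le> l m\<close>.\<close>

definition multigeometric ::
    "(nat \<Rightarrow> real) \<Rightarrow> nat \<Rightarrow> (nat \<Rightarrow> nat) \<Rightarrow> real \<Rightarrow> bool" where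
  "multigeometric a m l q \<longleftrightarrow>
     monotone_series a \<and> 1 \<le> m \<and>
     (\<forall>i\<in>{1..m}. 0 < l i) \<and> (\<forall>i\<in>{1..m}. \<forall>j\<in>{1..m}. i \<le> j \<longrightarrow> l j \<le> l i) \<and>
     0 < q \<and> q < 1 \<and>
     (\<forall>k. \<forall>i\<in>{1..m}. a (k * m + i) = real (l i) * q ^ k)"

definition subsums :: "(nat \<Rightarrow> real) \<Rightarrow> real set" where
  "subsums a = {\<Sum>\<^sub>\<infinity>n\<in>A. a n | A. A \<subseteq> {1..}}"

definition initial_subsums :: "(nat \<Rightarrow> real) \<Rightarrow> nat \<Rightarrow> real set" where
  "initial_subsums a k = {\<Sum>n\<in>A. a n | A. A \<subseteq> {1..k}}"

definition center_of_distances :: "'a::metric_space set \<Rightarrow> real set" where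
  "center_of_distances A = {\<alpha>. 0 \<le> \<alpha> \<and> (\<forall>x\<in>A. \<exists>y\<in>A. dist x y = \<alpha>)}"

text \<open>Meaningful only for finite sets with at least two elements.\<close>

definition min_gap :: "real set \<Rightarrow> real" where
  "min_gap F = Min {\<bar>f - g\<bar> | f g. f \<in> F \<and> g \<in> F \<and> f \<noteq> g}"

end

theory Submission
  imports Defs "HOL-Library.Set_Algebras"
begin

text \<open>Write \<open>F\<close> for the set of \<open>m\<close>-initial subsums and \<open>E\<close> for the set of all subsums. Since
  \<open>a (m + n) = q * a n\<close>, the tail of the series after \<open>m\<close> terms is a copy of the series scaled
  by \<open>q\<close>, so \<open>E = F + q E\<close> (a Minkowski sum). Every point of \<open>E\<close> is thus a digit \<open>f \<in> F\<close> plus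
  a remainder in \<open>q E \<subseteq> [0, q s]\<close>.

  The center of distances of a summand is contained in that of a Minkowski sum: move the one
  component and keep the other (\<open>center_of_distances_set_plus\<close>). As \<open>E\<close> is the sum of the
  \<open>n\<close>-initial subsums and the subsums of the \<open>n\<close>-th tail, this gives the inclusion from right
  to left.

  For the other inclusion, let \<open>\<alpha> > 0\<close> be in the center of distances of \<open>E\<close>, and compare
  \<open>\<alpha>\<close> with \<open>q s\<close>.

  \<^item> If \<open>\<alpha> \<le> q s\<close>, two points of \<open>E\<close> at distance \<open>\<alpha>\<close> have digits at distance at most \<open>2 q s\<close>,
    hence equal digits. The distance \<open>\<alpha>\<close> is therefore realised between the remainders, and
    \<open>\<alpha> / q\<close> is again in the center of distances of \<open>E\<close> (\<open>small_center_distance\<close>).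
  \<^item> If \<open>\<alpha> > q s\<close>, then \<open>\<alpha>\<close> is in the center of distances of \<open>F\<close>
    (\<open>large_center_distance\<close>). The points \<open>0\<close> and \<open>q s\<close> of \<open>E\<close> have no point of \<open>E\<close> at distance
    \<open>\<alpha>\<close> to their left, so \<open>\<alpha>\<close> and \<open>q s + \<alpha>\<close> are in \<open>E\<close>. Their digits differ by at most
    \<open>2 q s\<close>, hence agree, and this leaves no room for a remainder in \<open>\<alpha>\<close>. So \<open>\<alpha>\<close> is an
    integer, and because remainders are less than \<open>1\<close>, the distance \<open>\<alpha>\<close> from a digit can only
    be attained at another digit.

  Dividing \<open>\<alpha>\<close> by \<open>q\<close> finitely often leads from the first case to the second, and each division
  is undone at the cost of \<open>m\<close> further terms in the initial subsums.\<close>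

section \<open>Centers of distances of Minkowski sums and dilations\<close>

lemma center_of_distances_set_plus:
  fixes A B :: "real set"
  shows "center_of_distances A \<subseteq> center_of_distances (A + B)"
    and "center_of_distances B \<subseteq> center_of_distances (A + B)"
  by (force simp: center_of_distances_def set_plus_def dist_real_def)+

lemma center_of_distances_dilation:
  fixes A :: "real set"
  assumes "0 < c" and "\<alpha> \<in> center_of_distances A"
  shows "c * \<alpha> \<in> center_of_distances ((*) c ` A)"
  using assms
  by (force simp: center_of_distances_def dist_real_def abs_mult simp flip: right_diff_distrib)

section \<open>Subsums and tails\<close>

lemma index_set_split:
  fixes A :: "nat set"
  assumes "A \<subseteq> {1..}"
  obtains B C where "B \<subseteq> {1..n}" "C \<subseteq> {1..}" "A = B \<union> (+) n ` C"
proof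
  show "A \<inter> {1..n} \<subseteq> {1..n}" by blast
  show "{i. 1 \<le> i \<and> n + i \<in> A} \<subseteq> {1..}" by auto
  show "A = A \<inter> {1..n} \<union> (+) n ` {i. 1 \<le> i \<and> n + i \<in> A}"
  proof (intro equalityI subsetI)
    fix x assume x: "x \<in> A"
    show "x \<in> A \<inter> {1..n} \<union> (+) n ` {i. 1 \<le> i \<and> n + i \<in> A}"
    proof (cases "x \<le> n")
      case True
      then show ?thesis using x assms by auto
    next
      case False
      then have "x = n + (x - n)" "x - n \<in> {i. 1 \<le> i \<and> n + i \<in> A}"
        using x by auto
      then show ?thesis by blast
    qed
  qed auto
qed

lemma disjoint_translate:
  fixes B C :: "nat set"
  assumes "B \<subseteq> {1..n}" "C \<subseteq> {1..}"
  shows "B \<inter> (+) n ` C = {}"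
  using assms by fastforce

lemma infsum_split:
  fixes a :: "nat \<Rightarrow> real"
  assumes "a summable_on {1..}" and BC: "B \<subseteq> {1..n}" "C \<subseteq> {1..}"
  shows "(\<Sum>\<^sub>\<infinity>i\<in>B \<union> (+) n ` C. a i) = sum a B + (\<Sum>\<^sub>\<infinity>i\<in>C. a (n + i))"
proof -
  have fin: "finite B"
    using BC(1) finite_subset by blast
  have "a summable_on (+) n ` C"
    by (rule summable_on_subset_banach[OF assms(1)]) (use BC in auto)
  then have "(\<Sum>\<^sub>\<infinity>i\<in>B \<union> (+) n ` C. a i) = infsum a B + infsum a ((+) n ` C)"
    using disjoint_translate[OF BC] fin by (intro infsum_Un_disjoint) auto
  also have "infsum a ((+) n ` C) = (\<Sum>\<^sub>\<infinity>i\<in>C. a (n + i))"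
    by (subst infsum_reindex) (auto simp: o_def)
  finally show ?thesis using fin by simp
qed

lemma sum_split:
  fixes a :: "nat \<Rightarrow> real"
  assumes BC: "B \<subseteq> {1..n}" "C \<subseteq> {1..N}"
  shows "(\<Sum>i\<in>B \<union> (+) n ` C. a i) = sum a B + (\<Sum>i\<in>C. a (n + i))"
proof -
  have "B \<inter> (+) n ` C = {}"
    by (rule disjoint_translate) (use BC in auto)
  moreover have "finite B" "finite C"
    using BC finite_subset by blast+
  ultimately have "(\<Sum>i\<in>B \<union> (+) n ` C. a i) = sum a B + sum a ((+) n ` C)"
    by (intro sum.union_disjoint) auto
  also have "sum a ((+) n ` C) = (\<Sum>i\<in>C. a (n + i))"
    by (subst sum.reindex) auto
  finally show ?thesis .
qed

lemma subsums_split: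
  assumes "a summable_on {1..}"
  shows "subsums a = initial_subsums a n + subsums (\<lambda>i. a (n + i))"
proof (intro equalityI subsetI)
  fix x assume "x \<in> subsums a"
  then obtain A where A: "A \<subseteq> {1..}" "x = infsum a A"
    by (auto simp: subsums_def)
  obtain B C where BC: "B \<subseteq> {1..n}" "C \<subseteq> {1..}" "A = B \<union> (+) n ` C"
    using A(1) by (rule index_set_split)
  have "x = sum a B + (\<Sum>\<^sub>\<infinity>i\<in>C. a (n + i))"
    using infsum_split[OF assms BC(1,2)] A(2) BC(3) by simp
  moreover have "sum a B \<in> initial_subsums a n"
    using BC(1) unfolding initial_subsums_def by blast
  moreover have "(\<Sum>\<^sub>\<infinity>i\<in>C. a (n + i)) \<in> subsums (\<lambda>i. a (n + i))"
    using BC(2) unfolding subsums_def by blast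
  ultimately show "x \<in> initial_subsums a n + subsums (\<lambda>i. a (n + i))"
    by (simp only: set_plus_intro)
next
  fix x assume "x \<in> initial_subsums a n + subsums (\<lambda>i. a (n + i))"
  then obtain B C where BC: "B \<subseteq> {1..n}" "C \<subseteq> {1..}"
    and "x = sum a B + (\<Sum>\<^sub>\<infinity>i\<in>C. a (n + i))"
    unfolding set_plus_def subsums_def initial_subsums_def by blast
  then have "x = infsum a (B \<union> (+) n ` C)"
    using infsum_split[OF assms BC] by simp
  moreover have "B \<union> (+) n ` C \<subseteq> {1..}"
    using BC by auto
  ultimately show "x \<in> subsums a"
    unfolding subsums_def by blast
qed

lemma initial_subsums_split:
  "initial_subsums a (n + N) = initial_subsums a n + initial_subsums (\<lambda>i. a (n + i)) N"
proof (intro equalityI subsetI)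
  fix x assume "x \<in> initial_subsums a (n + N)"
  then obtain A where A: "A \<subseteq> {1..n + N}" "x = sum a A"
    by (auto simp: initial_subsums_def)
  have "A \<subseteq> {1..}"
    using A(1) by auto
  then obtain B C where BC: "B \<subseteq> {1..n}" "C \<subseteq> {1..}" "A = B \<union> (+) n ` C"
    by (rule index_set_split)
  have C: "C \<subseteq> {1..N}"
    using A(1) BC(2,3) by fastforce
  have "x = sum a B + (\<Sum>i\<in>C. a (n + i))"
    using sum_split[OF BC(1) C] A(2) BC(3) by simp
  moreover have "sum a B \<in> initial_subsums a n"
    using BC(1) unfolding initial_subsums_def by blast
  moreover have "(\<Sum>i\<in>C. a (n + i)) \<in> initial_subsums (\<lambda>i. a (n + i)) N"
    using C unfolding initial_subsums_def by blast
  ultimately show "x \<in> initial_subsums a n + initial_subsums (\<lambda>i. a (n + i)) N"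
    by (simp only: set_plus_intro)
next
  fix x assume "x \<in> initial_subsums a n + initial_subsums (\<lambda>i. a (n + i)) N"
  then obtain B C where BC: "B \<subseteq> {1..n}" "C \<subseteq> {1..N}"
    and "x = sum a B + (\<Sum>i\<in>C. a (n + i))"
    unfolding set_plus_def initial_subsums_def by blast
  then have "x = sum a (B \<union> (+) n ` C)"
    using sum_split[OF BC] by simp
  moreover have "B \<union> (+) n ` C \<subseteq> {1..n + N}"
    using BC by auto
  ultimately show "x \<in> initial_subsums a (n + N)"
    unfolding initial_subsums_def by blast
qed

lemma subsums_dilation:
  assumes "\<And>n. 1 \<le> n \<Longrightarrow> b n = c * a n"
  shows "subsums b = (*) c ` subsums a"
proof -
  have "infsum b A = c * infsum a A" if "A \<subseteq> {1..}" for A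
  proof -
    have "infsum b A = (\<Sum>\<^sub>\<infinity>n\<in>A. c * a n)"
      by (rule infsum_cong) (use that assms in auto)
    then show ?thesis by (simp add: infsum_cmult_right')
  qed
  then show ?thesis
    by (simp add: subsums_def setcompr_eq_image image_image)
qed

lemma initial_subsums_dilation:
  assumes "\<And>n. 1 \<le> n \<Longrightarrow> b n = c * a n"
  shows "initial_subsums b N = (*) c ` initial_subsums a N"
proof -
  have "sum b A = c * sum a A" if "A \<subseteq> {1..N}" for A
  proof -
    have "sum b A = (\<Sum>n\<in>A. c * a n)"
      by (rule sum.cong) (use that assms in auto)
    then show ?thesis by (simp add: sum_distrib_left)
  qed
  then show ?thesis
    by (simp add: initial_subsums_def setcompr_eq_image image_image)
qed

lemma finite_initial_subsums: "finite (initial_subsums a n)"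
proof -
  have "initial_subsums a n = sum a ` Pow {1..n}"
    by (auto simp: initial_subsums_def)
  then show ?thesis by simp
qed

lemma min_gap_le:
  assumes "finite F" "f \<in> F" "g \<in> F" "f \<noteq> g"
  shows "min_gap F \<le> \<bar>f - g\<bar>"
proof -
  have "{\<bar>f - g\<bar> | f g. f \<in> F \<and> g \<in> F \<and> f \<noteq> g} \<subseteq> (\<lambda>(f, g). \<bar>f - g\<bar>) ` (F \<times> F)"
    by auto
  then have "finite {\<bar>f - g\<bar> | f g. f \<in> F \<and> g \<in> F \<and> f \<noteq> g}"
    using assms(1) finite_subset by blast
  then show ?thesis
    unfolding min_gap_def by (rule Min_le) (use assms in blast)
qed

text \<open>Terms with index in \<open>{1..}\<close> are addressed as \<open>k * m + i\<close> with a residue \<open>i\<close> in \<open>{1..m}\<close>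
  instead of \<open>{0..<m}\<close>, whence the shift by one in the division.\<close>

lemma multigeometric_shift:
  assumes "multigeometric a m l q" "1 \<le> n"
  shows "a (m + n) = q * a n"
proof -
  define k i where "k = (n - 1) div m" and "i = (n - 1) mod m + 1"
  have m: "1 \<le> m" and a: "\<And>k i. i \<in> {1..m} \<Longrightarrow> a (k * m + i) = real (l i) * q ^ k"
    using assms(1) by (auto simp: multigeometric_def)
  have i: "i \<in> {1..m}"
    using m by (simp add: i_def Suc_leI)
  have n: "n = k * m + i"
    using assms(2) div_mult_mod_eq[of "n - 1" m] by (simp add: k_def i_def)
  have "m + n = Suc k * m + i"
    using n by simp
  then have "a (m + n) = real (l i) * q ^ Suc k"
    using a[OF i, of "Suc k"] by metis
  also have "\<dots> = q * a n"
    using a[OF i, of k] n by simp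
  finally show ?thesis .
qed

lemma multigeometric_initial_subsums_Ints:
  assumes "multigeometric a m l q"
  shows "initial_subsums a m \<subseteq> \<int>"
proof
  fix x assume "x \<in> initial_subsums a m"
  then obtain A where A: "A \<subseteq> {1..m}" "x = sum a A"
    by (auto simp: initial_subsums_def)
  have "a i \<in> \<int>" if "i \<in> A" for i
  proof -
    have "a (0 * m + i) = real (l i) * q ^ 0"
      using assms that A(1) unfolding multigeometric_def by blast
    then show ?thesis by simp
  qed
  then show "x \<in> \<int>" using A by (simp add: Ints_sum)
qed

lemma subsums_bounds:
  assumes "(a has_sum s) {1..}" and "\<And>n. 1 \<le> n \<Longrightarrow> 0 \<le> a n"
  shows "subsums a \<subseteq> {0..s}"
proof
  fix x assume "x \<in> subsums a"
  then obtain A where A: "A \<subseteq> {1..}" "x = infsum a A"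
    by (auto simp: subsums_def)
  have sm: "a summable_on {1..}" and s: "s = infsum a {1..}"
    using assms(1) has_sum_imp_summable infsumI by blast+
  have "a summable_on A"
    using sm A(1) by (rule summable_on_subset_banach)
  then have "infsum a A \<le> infsum a {1..}"
    by (rule infsum_mono_neutral[OF _ sm]) (use A assms(2) in auto)
  moreover have "0 \<le> infsum a A"
    by (rule infsum_nonneg) (use A assms(2) in auto)
  ultimately show "x \<in> {0..s}" using A s by simp
qed

section \<open>Self-similar sets with well separated digits\<close>

lemma self_similar_cases:
  fixes E F :: "real set"
  assumes "E = F + (*) q ` E" "E \<subseteq> {0..s}" "0 < q" "x \<in> E"
  obtains f e where "f \<in> F" "e \<in> E" "x = f + q * e" "0 \<le> q * e" "q * e \<le> q * s"
proof -
  have "x \<in> F + (*) q ` E"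
    using assms(1,4) by (rule subst)
  then obtain f e where "f \<in> F" "e \<in> E" "x = f + q * e"
    by (auto simp: set_plus_def)
  moreover have "0 \<le> q * e" "q * e \<le> q * s"
    using assms(2,3) \<open>e \<in> E\<close> by auto
  ultimately show thesis using that by blast
qed

lemma self_similarI:
  fixes E F :: "real set"
  assumes "E = F + (*) q ` E" "f \<in> F" "e \<in> E"
  shows "f + q * e \<in> E"
  by (subst assms(1)) (intro set_plus_intro imageI assms)

text \<open>A distance of at most \<open>q * s\<close> is too short to lead to another digit, even when the
  remainders compensate by \<open>q * s\<close>.\<close>

lemma small_center_distance:
  fixes E F :: "real set"
  assumes similar: "E = F + (*) q ` E" and bounds: "E \<subseteq> {0..s}" and "0 < q" and "F \<noteq> {}"
    and sep: "\<And>f g. f \<in> F \<Longrightarrow> g \<in> F \<Longrightarrow> f \<noteq> g \<Longrightarrow> 2 * q * s < \<bar>f - g\<bar>"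
    and \<alpha>: "\<alpha> \<in> center_of_distances E" "\<alpha> \<le> q * s"
  shows "\<alpha> / q \<in> center_of_distances E"
proof -
  have "\<exists>e'\<in>E. dist e e' = \<alpha> / q" if e: "e \<in> E" for e
  proof -
    obtain f where f: "f \<in> F" using \<open>F \<noteq> {}\<close> by blast
    have e_bounds: "0 \<le> q * e" "q * e \<le> q * s"
      using e bounds \<open>0 < q\<close> by auto
    have "f + q * e \<in> E"
      using self_similarI[OF similar f e] .
    then obtain y where y: "y \<in> E" "\<bar>f + q * e - y\<bar> = \<alpha>"
      using \<alpha>(1) by (auto simp: center_of_distances_def dist_real_def)
    obtain g e' where g: "g \<in> F" and e': "e' \<in> E" "y = g + q * e'" "0 \<le> q * e'" "q * e' \<le> q * s"
      using self_similar_cases[OF similar bounds \<open>0 < q\<close> y(1)] .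
    have "\<bar>f - g\<bar> \<le> 2 * q * s"
      using y(2) e' e_bounds \<alpha>(2) by linarith
    then have "f = g"
      using sep[OF f g] by linarith
    then have "\<bar>q * (e - e')\<bar> = \<alpha>"
      using y(2) e'(2) by (simp add: right_diff_distrib)
    then have "dist e e' = \<alpha> / q"
      using \<open>0 < q\<close> by (auto simp: dist_real_def abs_mult)
    then show ?thesis using e' by blast
  qed
  then show ?thesis
    using \<alpha>(1) \<open>0 < q\<close> by (simp add: center_of_distances_def)
qed

text \<open>Separation forces \<open>\<alpha>\<close> to be a digit: otherwise the points \<open>\<alpha>\<close> and \<open>q * s + \<alpha>\<close> of \<open>E\<close> would
  have distinct digits that are too close. Integrality then turns a point of \<open>E\<close> at distance \<open>\<alpha>\<close>
  from a digit into a digit.\<close>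

lemma large_center_distance:
  fixes E F :: "real set"
  assumes similar: "E = F + (*) q ` E" and bounds: "E \<subseteq> {0..s}" and "0 < q"
    and "0 \<in> F" and "0 \<in> E" and "s \<in> E"
    and sep: "\<And>f g. f \<in> F \<Longrightarrow> g \<in> F \<Longrightarrow> f \<noteq> g \<Longrightarrow> 2 * q * s < \<bar>f - g\<bar>"
    and ints: "F \<subseteq> \<int>" and "q * s < 1"
    and \<alpha>: "\<alpha> \<in> center_of_distances E" "q * s < \<alpha>"
  shows "\<alpha> \<in> center_of_distances F"
proof -
  note digit = self_similar_cases[OF similar bounds \<open>0 < q\<close>]
  have dist_E: "\<exists>y\<in>E. \<bar>x - y\<bar> = \<alpha>" if "x \<in> E" for x
    using \<alpha>(1) that by (auto simp: center_of_distances_def dist_real_def)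
  have right: "x + \<alpha> \<in> E" if "x \<in> E" "x \<le> q * s" for x
  proof -
    obtain y where y: "y \<in> E" "\<bar>x - y\<bar> = \<alpha>"
      using dist_E \<open>x \<in> E\<close> by blast
    have "0 \<le> y"
      using y(1) bounds by auto
    then have "y = x + \<alpha>"
      using y(2) \<alpha>(2) that(2) by linarith
    then show ?thesis
      using y(1) by simp
  qed
  have "0 + q * s \<in> E"
    using self_similarI[OF similar \<open>0 \<in> F\<close> \<open>s \<in> E\<close>] .
  then have qs: "q * s \<in> E" by simp
  have "0 \<le> q * s"
    using qs bounds by auto
  then have "\<alpha> \<in> E"
    using right[OF \<open>0 \<in> E\<close>] by simp
  then obtain h e where h: "h \<in> F" and e: "\<alpha> = h + q * e" "0 \<le> q * e" "q * e \<le> q * s"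
    by (rule digit)
  obtain g e' where g: "g \<in> F" and e': "q * s + \<alpha> = g + q * e'" "0 \<le> q * e'" "q * e' \<le> q * s"
    using digit[OF right[OF qs order_refl]] by metis
  \<comment> \<open>Here \<open>g - h\<close> is \<open>q * e\<close> plus the nonnegative \<open>q * s - q * e'\<close>.\<close>
  have "\<bar>g - h\<bar> \<le> 2 * q * s"
    using e e' by linarith
  then have "g = h"
    using sep[OF g h] by linarith
  then have "q * e = 0"
    using e e' by linarith
  then have "\<alpha> \<in> \<int>"
    using e(1) h ints by auto
  have "\<exists>g\<in>F. dist f g = \<alpha>" if f: "f \<in> F" for f
  proof -
    have "f + q * 0 \<in> E"
      using self_similarI[OF similar f \<open>0 \<in> E\<close>] .
    then obtain y where y: "y \<in> E" "\<bar>f - y\<bar> = \<alpha>"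
      using dist_E by fastforce
    obtain g e where g: "g \<in> F" and e: "y = g + q * e" "0 \<le> q * e" "q * e \<le> q * s"
      using digit[OF y(1)] .
    have "q * e = f - g - \<alpha> \<or> q * e = f - g + \<alpha>"
      using y(2) e(1) by linarith
    moreover have "f \<in> \<int>" "g \<in> \<int>"
      using f g ints by auto
    ultimately have "q * e \<in> \<int>"
      using \<open>\<alpha> \<in> \<int>\<close> by auto
    moreover have "\<bar>q * e\<bar> < 1"
      using e \<open>q * s < 1\<close> by linarith
    ultimately have "q * e = 0"
      using Ints_nonzero_abs_less1 by blast
    then have "dist f g = \<alpha>"
      using y(2) e(1) unfolding dist_real_def by linarith
    then show ?thesis
      using g by blast
  qed
  then show ?thesis
    using \<alpha>(1) by (simp add: center_of_distances_def)
qed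

section \<open>The center of distances of a multigeometric series\<close>

theorem corollary4p6:
  fixes a :: "nat \<Rightarrow> real" and m :: nat and l :: "nat \<Rightarrow> nat" and q s :: real
  assumes "multigeometric a m l q"
    and "(a has_sum s) {1..}"
    and "2 * q * s < min_gap (initial_subsums a m)"
    and "q * s < 1"
  shows "center_of_distances (subsums a) =
         (\<Union>n\<in>{1..}. center_of_distances (initial_subsums a n))"
proof (intro equalityI subsetI)
  fix \<alpha> assume "\<alpha> \<in> (\<Union>n\<in>{1..}. center_of_distances (initial_subsums a n))"
  then show "\<alpha> \<in> center_of_distances (subsums a)"
    using subsums_split[OF has_sum_imp_summable[OF assms(2)]] center_of_distances_set_plus(1)
    by (metis UN_E subsetD)
next
  define E F where "E = subsums a" and "F = initial_subsums a m"
  have "0 < q" "q < 1" "1 \<le> m" and pos: "\<And>n. 1 \<le> n \<Longrightarrow> 0 \<le> a n"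
    using assms(1) by (auto simp: multigeometric_def monotone_series_def intro: less_imp_le)
  note shift = multigeometric_shift[OF assms(1)]
  have similar: "E = F + (*) q ` E"
    using subsums_split[OF has_sum_imp_summable[OF assms(2)], of m]
      subsums_dilation[of "\<lambda>i. a (m + i)" q a, OF shift]
    by (simp add: E_def F_def)
  have bounds: "E \<subseteq> {0..s}"
    unfolding E_def using subsums_bounds[OF assms(2) pos] .
  have "0 \<in> E" "0 \<in> F"
    by (auto simp: E_def F_def subsums_def initial_subsums_def intro!: exI[of _ "{}"])
  have "s \<in> E"
    using infsumI[OF assms(2)] by (auto simp: E_def subsums_def)
  have ints: "F \<subseteq> \<int>"
    unfolding F_def using multigeometric_initial_subsums_Ints[OF assms(1)] .
  have sep: "2 * q * s < \<bar>f - g\<bar>" if "f \<in> F" "g \<in> F" "f \<noteq> g" for f g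
    using min_gap_le[OF finite_initial_subsums] that assms(3) unfolding F_def
    by (metis less_le_trans)

  \<comment> \<open>The bound on \<open>\<alpha>\<close> says that at most \<open>n\<close> divisions by \<open>q\<close> lift it above \<open>q * s\<close>.\<close>
  have descent: "\<exists>N\<ge>1. \<alpha> \<in> center_of_distances (initial_subsums a N)"
    if "\<alpha> \<in> center_of_distances E" "q ^ n * (q * s) < \<alpha>" for n \<alpha>
    using that
  proof (induction n arbitrary: \<alpha>)
    case 0
    then have "\<alpha> \<in> center_of_distances F"
      using large_center_distance[OF similar bounds \<open>0 < q\<close> \<open>0 \<in> F\<close> \<open>0 \<in> E\<close> \<open>s \<in> E\<close> sep ints assms(4)]
      by simp
    then show ?case
      using \<open>1 \<le> m\<close> F_def by blast
  next
    case (Suc n)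
    show ?case
    proof (cases "\<alpha> \<le> q * s")
      case True
      have "\<alpha> / q \<in> center_of_distances E"
        using small_center_distance[OF similar bounds \<open>0 < q\<close> _ sep Suc.prems(1) True] \<open>0 \<in> F\<close>
        by blast
      moreover have "q ^ n * (q * s) < \<alpha> / q"
        using Suc.prems(2) \<open>0 < q\<close> by (simp add: pos_less_divide_eq mult_ac)
      ultimately obtain N where N: "1 \<le> N" "\<alpha> / q \<in> center_of_distances (initial_subsums a N)"
        using Suc.IH by blast
      have "q * (\<alpha> / q) \<in> center_of_distances ((*) q ` initial_subsums a N)"
        using center_of_distances_dilation[OF \<open>0 < q\<close> N(2)] .
      also have "(*) q ` initial_subsums a N = initial_subsums (\<lambda>i. a (m + i)) N"
        using initial_subsums_dilation[of "\<lambda>i. a (m + i)" q a, OF shift] by simp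
      also have "center_of_distances \<dots> \<subseteq> center_of_distances (initial_subsums a (m + N))"
        unfolding initial_subsums_split by (rule center_of_distances_set_plus(2))
      finally have "\<alpha> \<in> center_of_distances (initial_subsums a (m + N))"
        using \<open>0 < q\<close> by simp
      then show ?thesis
        using N(1) by (intro exI[of _ "m + N"]) auto
    next
      case False
      \<comment> \<open>Then the bound of the case \<open>n = 0\<close> holds already.\<close>
      then have "\<alpha> \<in> center_of_distances F"
        using large_center_distance[OF similar bounds \<open>0 < q\<close> \<open>0 \<in> F\<close> \<open>0 \<in> E\<close> \<open>s \<in> E\<close> sep ints assms(4)]
          Suc.prems(1) by simp
      then show ?thesis
        using \<open>1 \<le> m\<close> F_def by blast
    qed
  qed

  fix \<alpha> assume "\<alpha> \<in> center_of_distances (subsums a)"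
  then have \<alpha>: "\<alpha> \<in> center_of_distances E" "0 \<le> \<alpha>"
    by (auto simp: E_def center_of_distances_def)
  show "\<alpha> \<in> (\<Union>n\<in>{1..}. center_of_distances (initial_subsums a n))"
  proof (cases "\<alpha> = 0")
    case True
    then show ?thesis
      by (force simp: center_of_distances_def)
  next
    case False
    have "(\<lambda>n. q ^ n * (q * s)) \<longlonglongrightarrow> 0 * (q * s)"
      using \<open>0 < q\<close> \<open>q < 1\<close> by (intro tendsto_intros LIMSEQ_power_zero) auto
    then have "eventually (\<lambda>n. q ^ n * (q * s) < \<alpha>) sequentially"
      using False \<alpha>(2) by (intro order_tendstoD) auto
    then obtain n where "q ^ n * (q * s) < \<alpha>"
      by (meson eventually_happens trivial_limit_sequentially)
    then show ?thesis
      using descent[OF \<alpha>(1)] by auto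
  qed
qed

end
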